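(* Let $\kappa$ be a cardinal on which a tortuous coloring exists. Then ${\rm cov}^{\ast}(\mathcal{Z}_0) \leq \max\{\kappa, \mathfrak{b}\}$.
   Context: $\omega$ is the set of natural numbers. A partition of a set $S$ indexed by $\omega$ is a sequence $\langle K_n:n\in\omega\rangle$ of pairwise disjoint (possibly empty) subsets of $S$ with union $S$. A coloring $c:\kappa\times\omega\times\omega\to 2$ is tortuous (a tortuous coloring on $\kappa$) if for each infinite $A\subseteq\omega$ and each partition $\langle K_n:n\in\omega\rangle$ of $\kappa$ there exists $n\in\omega$ such that for every $\sigma\in 2^{n+1}$ there exist $\alpha\in K_n$ and $k\in A$ with $k>n$ and $\sigma(i)=c(\alpha,k,i)$ for all $i<n+1$. $\mathcal{Z}_0$ is the ideal of all $A\subseteq\omega$ with $\lim_{n\to\infty}|A\cap n|/n=0$. ${\rm cov}^{\ast}(\mathcal{Z}_0)$ is the least size of a family $\mathcal{F}\subseteq\mathcal{Z}_0$ such that every infinite $a\subseteq\omega$ has infinite intersection with some $b\in\mathcal{F}$. $\mathfrak{b}$ is the bounding number. *)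

theory Defs
  imports Complex_Main "HOL-Library.Disjoint_Sets"
begin

unbundle cardinal_syntax

text \<open>
  Cardinals are the cardinal orders of the BNF library: a cardinal \<open>\<kappa>\<close> is a relation with
  \<open>Card_order \<kappa>\<close>, and the set of ordinals below it is represented by \<open>Field \<kappa>\<close>.
  The set 2 is represented by \<open>bool\<close>.
\<close>

definition indexed_partition :: "(nat \<Rightarrow> 'a set) \<Rightarrow> 'a set \<Rightarrow> bool" where
  "indexed_partition K S \<longleftrightarrow> disjoint_family K \<and> (\<Union>n. K n) = S"

text \<open>
  An element of \<open>2\<^sup>n\<^sup>+\<^sup>1\<close> is given by a total function of which only the
  values at arguments below \<open>n + 1\<close> matter; likewise the values of \<open>c\<close> outside
  \<open>Field \<kappa>\<close> are irrelevant.
\<close>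

definition tortuous :: "'a rel \<Rightarrow> ('a \<Rightarrow> nat \<Rightarrow> nat \<Rightarrow> bool) \<Rightarrow> bool" where
  "tortuous \<kappa> c \<longleftrightarrow>
     (\<forall>A K. infinite A \<longrightarrow> indexed_partition K (Field \<kappa>) \<longrightarrow>
       (\<exists>n. \<forall>\<sigma> :: nat \<Rightarrow> bool. \<exists>\<alpha>\<in>K n. \<exists>k\<in>A. k > n \<and> (\<forall>i<n + 1. \<sigma> i = c \<alpha> k i)))"

definition Z0 :: "nat set set" where
  "Z0 = {A. (\<lambda>n. real (card (A \<inter> {..<n})) / real n) \<longlonglongrightarrow> 0}"

text \<open>
  The least cardinality of a member of \<open>\<F>\<close>, as a cardinal determined up to \<open>=o\<close>.
  By well-foundedness it is attained whenever \<open>\<F>\<close> is nonempty.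
\<close>

definition least_size :: "'a set set \<Rightarrow> 'a rel" where
  "least_size \<F> = |SOME F. F \<in> \<F> \<and> (\<forall>G\<in>\<F>. |F| \<le>o |G| )|"

lemma least_size_attained:
  assumes "\<F> \<noteq> {}"
  obtains F where "F \<in> \<F>" "least_size \<F> = |F|" "\<And>G. G \<in> \<F> \<Longrightarrow> |F| \<le>o |G|"
proof -
  have "\<exists>r \<in> card_of ` \<F>. \<forall>r' \<in> card_of ` \<F>. r \<le>o r'"
    using assms by (intro exists_minim_Card_order) (auto simp: card_of_Card_order)
  then have "\<exists>F. F \<in> \<F> \<and> (\<forall>G\<in>\<F>. |F| \<le>o |G| )" by auto
  from someI_ex[OF this] show thesis
    using that unfolding least_size_def by blast
qed

definition cov_star_Z0 :: "nat set rel" where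
  "cov_star_Z0 =
     least_size {F. F \<subseteq> Z0 \<and> (\<forall>a. infinite a \<longrightarrow> (\<exists>b\<in>F. infinite (a \<inter> b)))}"

definition bounding_number :: "(nat \<Rightarrow> nat) rel" where
  "bounding_number = least_size {F. \<not> (\<exists>g. \<forall>f\<in>F. \<forall>\<^sub>F n in sequentially. f n \<le> g n)}"

text \<open>The maximum of two cardinals on possibly different types, as a cardinal on the sum type.\<close>

definition card_max :: "'a rel \<Rightarrow> 'b rel \<Rightarrow> ('a + 'b) rel" where
  "card_max r s = (if r \<le>o s then |Inr ` Field s| else |Inl ` Field r| )"

end

theory Submission
  imports Defs "HOL-Library.Discrete_Functions"
begin

text \<open>
  Write \<open>k = floor_log x\<close>. For a function \<open>d\<close> and \<open>f : \<omega> \<rightarrow> \<omega>\<close>, the \<open>x\<close> whose lowest \<open>m\<close> binary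
  digits agree with \<open>d k\<close>, where \<open>m\<close> is least with \<open>k \<le> f m\<close>, form a set in \<open>\<Z>\<^sub>0\<close>, as \<open>m\<close>
  tends to infinity with \<open>k\<close>. Let \<open>d\<close> range over the functions \<open>c \<alpha>\<close> and \<open>f\<close> over an unbounded
  family. An infinite set of naturals contains a sequence whose binary digits converge to some
  \<open>s\<close>. If no \<open>c \<alpha>\<close> had arbitrarily long agreement with this sequence, partitioning \<open>\<kappa>\<close>
  according to the bound on the agreement and testing tortuosity at \<open>\<sigma> = s\<close> would give a
  contradiction. Given an \<open>\<alpha>\<close> with arbitrarily long agreement, some \<open>f\<close> grows fast enough for
  the corresponding set to contain infinitely many members of the sequence.
\<close>

text \<open>Agreement below \<open>n\<close> implies agreement below any smaller bound, so the
  existential amounts to taking the least \<open>n\<close> with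
  \<open>floor_log x \<le> f n\<close>.\<close>

definition agreement_set :: "(nat \<Rightarrow> nat \<Rightarrow> bool) \<Rightarrow> (nat \<Rightarrow> nat) \<Rightarrow> nat set" where
  "agreement_set d f = {x. \<exists>n. floor_log x \<le> f n \<and> (\<forall>i<n. bit x i = d (floor_log x) i)}"

section \<open>Agreement sets have density zero\<close>

lemma floor_log_div_power2: "floor_log (x div 2 ^ m) = floor_log x - m"
proof (induction m)
  case (Suc m)
  have "floor_log (x div 2 ^ Suc m) = floor_log (x div 2 ^ m div 2)"
    by (simp only: div_mult2_eq power_Suc2)
  then show ?case using Suc.IH by simp
qed simp

lemma power2_le_imp_le_floor_log: "2 ^ m \<le> x \<Longrightarrow> m \<le> floor_log x"
  using floor_log_le_iff[of "2 ^ m" x] by simp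

text \<open>The lower bounds keep the subtraction in \<open>floor_log x - m\<close> from truncating,
  so the quotient determines \<open>floor_log x\<close>.\<close>

lemma floor_log_eq_if_div_eq:
  assumes "x div 2 ^ m = y div 2 ^ m" and "2 ^ m \<le> x" and "2 ^ m \<le> y"
  shows "floor_log x = floor_log y"
  using floor_log_div_power2[of x m] floor_log_div_power2[of y m] assms(1)
    power2_le_imp_le_floor_log[OF assms(2)] power2_le_imp_le_floor_log[OF assms(3)]
  by simp

text \<open>At most \<open>N0\<close> elements lie below \<open>N0\<close>; the others below
  \<open>N\<close> inject into the quotients up to \<open>N div q\<close>.\<close>

lemma card_Int_lessThan_le:
  assumes "inj_on (\<lambda>x. x div q) {x \<in> A. N0 \<le> x}"
  shows "card (A \<inter> {..<N}) \<le> N0 + (N div q + 1)"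
proof -
  let ?B = "{x \<in> A. N0 \<le> x} \<inter> {..<N}"
  have "card ?B = card ((\<lambda>x. x div q) ` ?B)"
    using assms by (intro card_image[symmetric]) (auto intro: inj_on_subset)
  also have "\<dots> \<le> card {..N div q}" by (intro card_mono) (auto intro: div_le_mono)
  finally have "card ?B \<le> N div q + 1" by simp
  moreover have "card (A \<inter> {..<N}) \<le> card ({..<N0} \<union> ?B)" by (intro card_mono) auto
  ultimately show ?thesis using card_Un_le[of "{..<N0}" ?B] by simp
qed

text \<open>Beyond \<open>N0\<close>, each block of length \<open>2 ^ M\<close> meets
  \<open>A\<close> at most once, so the upper density is at most \<open>1 / 2 ^ M\<close> for every
  \<open>M\<close>.\<close>

lemma Z0_I:
  assumes "\<And>M. \<exists>N0. inj_on (\<lambda>x. x div 2 ^ M) {x \<in> A. N0 \<le> x}"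
  shows "A \<in> Z0"
  unfolding Z0_def mem_Collect_eq
proof (rule LIMSEQ_I)
  fix r :: real assume r: "r > 0"
  then obtain M where M: "(1/2) ^ M < r / 2"
    using real_arch_pow_inv[of "r/2" "1/2"] by auto
  from assms obtain N0 where inj: "inj_on (\<lambda>x. x div 2 ^ M) {x \<in> A. N0 \<le> x}" by blast
  \<comment> \<open>For \<open>n > N1\<close> the constant \<open>N0 + 1\<close> stays below
    \<open>n * r / 2\<close>; the choice of \<open>M\<close> keeps the quotient term within the
    other half.\<close>
  obtain N1 :: nat where N1: "real N1 > 2 * (N0 + 1) / r" using reals_Archimedean2 by blast
  show "\<exists>N. \<forall>n\<ge>N. norm (real (card (A \<inter> {..<n})) / real n - 0) < r"
  proof (intro exI[of _ "Suc N1"] allI impI)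
    fix n assume n: "Suc N1 \<le> n"
    then have n_pos: "real n > 0" by simp
    have "real (card (A \<inter> {..<n})) \<le> real (N0 + 1) + real (n div 2 ^ M)"
      using card_Int_lessThan_le[OF inj, of n] by linarith
    also have "real (n div 2 ^ M) \<le> real n * (1/2) ^ M"
      using of_nat_div_le_of_nat[of n "2 ^ M", where 'a = real] by (simp add: power_one_over)
    finally have "real (card (A \<inter> {..<n})) \<le> real (N0 + 1) + real n * (1/2) ^ M" by simp
    moreover have "real n * (1/2) ^ M \<le> real n * (r / 2)" using M by (intro mult_left_mono) auto
    moreover have "real (N0 + 1) < real n * (r / 2)"
    proof -
      have "2 * (N0 + 1) / r < real n" using N1 n by linarith
      then show ?thesis using r by (simp add: field_simps)
    qed
    ultimately have "real (card (A \<inter> {..<n})) < r * real n" by (simp add: algebra_simps)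
    then show "norm (real (card (A \<inter> {..<n})) / real n - 0) < r"
      using n_pos by (simp add: divide_less_eq)
  qed
qed

text \<open>For large \<open>x\<close> in the set, \<open>x div 2 ^ M\<close> determines
  \<open>floor_log x\<close>, which through \<open>d\<close> determines the lowest \<open>M\<close>
  digits; hence the quotient determines \<open>x\<close>.\<close>

lemma agreement_set_in_Z0: "agreement_set d f \<in> Z0"
proof (rule Z0_I)
  fix M
  \<comment> \<open>Exceeds every \<open>f n\<close> with \<open>n < M\<close>, so that a witness of
    membership is at least \<open>M\<close>; exceeds \<open>M\<close>, so that quotients determine
    \<open>floor_log\<close>.\<close>
  define k0 where "k0 = Suc (M + (\<Sum>n<M. f n))"
  have "inj_on (\<lambda>x. x div 2 ^ M) {x \<in> agreement_set d f. 2 ^ k0 \<le> x}"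
  proof (rule inj_onI)
    fix x y
    assume x: "x \<in> {x \<in> agreement_set d f. 2 ^ k0 \<le> x}"
      and y: "y \<in> {x \<in> agreement_set d f. 2 ^ k0 \<le> x}"
      and eq: "x div 2 ^ M = y div 2 ^ M"
    have low: "bit z i = d (floor_log z) i"
      if z: "z \<in> {x \<in> agreement_set d f. 2 ^ k0 \<le> x}" and i: "i < M" for z i
    proof -
      have "k0 \<le> floor_log z" using z by (simp add: power2_le_imp_le_floor_log)
      moreover obtain n where n: "floor_log z \<le> f n" "\<forall>i<n. bit z i = d (floor_log z) i"
        using z by (auto simp: agreement_set_def)
      moreover have "f n \<le> (\<Sum>n<M. f n)" if "n < M" using that by (intro member_le_sum) auto
      ultimately have "M \<le> n" by (fastforce simp: k0_def)
      then show ?thesis using n(2) i by simp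
    qed
    have le: "(2::nat) ^ M \<le> 2 ^ k0" by (intro power_increasing) (simp_all add: k0_def)
    have "2 ^ M \<le> x" "2 ^ M \<le> y" using x y order_trans[OF le] by blast+
    then have k: "floor_log x = floor_log y" by (rule floor_log_eq_if_div_eq[OF eq])
    show "x = y"
    proof (rule bit_eqI)
      fix i
      show "bit x i = bit y i"
      proof (cases "i < M")
        case True
        then show ?thesis using low[OF x] low[OF y] k by simp
      next
        case False
        have "bit z i = bit (z div 2 ^ M) (i - M)" for z :: nat
          using False by (simp add: bit_iff_odd div_mult2_eq[symmetric] flip: power_add)
        then show ?thesis using eq by simp
      qed
    qed
  qed
  then show "\<exists>N0. inj_on (\<lambda>x. x div 2 ^ M) {x \<in> agreement_set d f. N0 \<le> x}" by blast
qed

section \<open>Sequences with converging binary digits\<close>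

text \<open>Compactness of the Cantor space: splitting by the next digit and keeping an infinite
  half fixes one more value of \<open>s\<close> each time.\<close>

lemma infinite_set_limit:
  fixes p :: "'a \<Rightarrow> nat \<Rightarrow> bool"
  assumes "infinite a"
  obtains s where "\<And>n. infinite {x \<in> a. \<forall>i<n. p x i = s i}"
proof -
  have "\<exists>X. \<forall>n. (infinite (X n) \<and> X n \<subseteq> a) \<and>
      (X (Suc n) \<subseteq> X n \<and> (\<exists>b. \<forall>x\<in>X (Suc n). p x n = b))"
  proof (rule dependent_nat_choice)
    show "\<exists>X. infinite X \<and> X \<subseteq> a" using assms by blast
  next
    fix X n assume X: "infinite X \<and> X \<subseteq> a"
    have "X = {x \<in> X. p x n} \<union> {x \<in> X. \<not> p x n}" by blast
    then have "infinite {x \<in> X. p x n} \<or> infinite {x \<in> X. \<not> p x n}"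
      using X by (metis finite_Un)
    then obtain b where "infinite {x \<in> X. p x n = b}" 
      using that[of True] that[of False] by auto
    then show "\<exists>Y. (infinite Y \<and> Y \<subseteq> a) \<and> (Y \<subseteq> X \<and> (\<exists>b. \<forall>x\<in>Y. p x n = b))"
      using X by (intro exI[of _ "{x \<in> X. p x n = b}"]) auto
  qed
  then obtain X where inf: "\<And>n. infinite (X n)" and sub: "\<And>n. X n \<subseteq> a"
    and step: "\<And>n. X (Suc n) \<subseteq> X n" and const: "\<And>n. \<exists>b. \<forall>x\<in>X (Suc n). p x n = b"
    by blast
  from const obtain s where s: "\<And>n x. x \<in> X (Suc n) \<Longrightarrow> p x n = s n" by metis
  have anti: "X n \<subseteq> X m" if "m \<le> n" for m n
    using lift_Suc_antimono_le[of X, OF step that] .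
  have "infinite {x \<in> a. \<forall>i<n. p x i = s i}" for n
  proof (rule infinite_super[OF _ inf])
    have "p x i = s i" if "x \<in> X n" "i < n" for x i
      using anti[of "Suc i" n] that by (intro s) auto
    then show "X n \<subseteq> {x \<in> a. \<forall>i<n. p x i = s i}" using sub by blast
  qed
  then show thesis by (rule that)
qed

lemma finite_floor_log_le: "finite {x. floor_log x \<le> k}"
proof (rule finite_subset)
  show "{x. floor_log x \<le> k} \<subseteq> {..<2 ^ Suc k}"
  proof clarify
    fix x assume "floor_log x \<le> k"
    then have "(2::nat) * 2 ^ floor_log x \<le> 2 ^ Suc k" by simp
    with floor_log_exp2_gt show "x < 2 ^ Suc k" by (rule less_le_trans)
  qed
qed simp

lemma rapidly_converging_sequence:
  assumes "infinite (a :: nat set)"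
  obtains x :: "nat \<Rightarrow> nat" and s where "range x \<subseteq> a" and "strict_mono (\<lambda>j. floor_log (x j))"
    and "\<forall>j. \<forall>i<j. \<forall>m \<le> floor_log (x i). bit (x j) m = s m"
proof -
  obtain s where s: "\<And>n. infinite {x \<in> a. \<forall>i<n. bit x i = s i}"
    using infinite_set_limit[OF assms] by blast
  have "\<exists>x. \<forall>n::nat. x n \<in> a \<and> (floor_log (x n) < floor_log (x (Suc n)) \<and>
      (\<forall>i \<le> floor_log (x n). bit (x (Suc n)) i = s i))"
  proof (rule dependent_nat_choice)
    show "\<exists>x. x \<in> a" using assms by (metis equals0I finite.emptyI)
  next
    fix x n
    let ?X = "{y \<in> a. \<forall>i < Suc (floor_log x). bit y i = s i}"
    have "infinite (?X - {y. floor_log y \<le> floor_log x})"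
      by (rule Diff_infinite_finite[OF finite_floor_log_le s])
    then obtain y where "y \<in> ?X - {y. floor_log y \<le> floor_log x}"
      using infinite_imp_nonempty by blast
    then show "\<exists>y. y \<in> a \<and> floor_log x < floor_log y \<and> (\<forall>i \<le> floor_log x. bit y i = s i)"
      by (intro exI[of _ y]) auto
  qed
  then obtain x where xa: "\<And>n. x n \<in> a" and lt: "\<And>n. floor_log (x n) < floor_log (x (Suc n))"
    and lim: "\<And>n i. i \<le> floor_log (x n) \<Longrightarrow> bit (x (Suc n)) i = s i" by blast
  have mono: "strict_mono (\<lambda>j. floor_log (x j))" using lt by (simp add: strict_mono_Suc_iff)
  have "bit (x j) m = s m" if "i < j" and m: "m \<le> floor_log (x i)" for i j m
  proof -
    obtain j' where j': "j = Suc j'" "i \<le> j'" using \<open>i < j\<close> by (cases j) auto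
    have "floor_log (x i) \<le> floor_log (x j')" using strict_mono_leD[OF mono j'(2)] .
    then show ?thesis using lim[of m j'] m j' by simp
  qed
  then show thesis by (intro that[of x s]) (use xa mono in auto)
qed

section \<open>Use of tortuosity and of an unbounded family\<close>

lemma tortuous_long_agreement:
  fixes x :: "nat \<Rightarrow> nat"
  assumes "tortuous \<kappa> c" and mono: "strict_mono (\<lambda>j. floor_log (x j))"
    and lim: "\<forall>j. \<forall>i<j. \<forall>m \<le> floor_log (x i). bit (x j) m = s m"
  shows "\<exists>\<alpha>\<in>Field \<kappa>. \<forall>n. \<exists>j. n \<le> floor_log (x j) \<and> (\<forall>i<n. bit (x j) i = c \<alpha> (floor_log (x j)) i)"
proof (rule ccontr)
  assume "\<not> ?thesis"
  then have "\<forall>\<alpha>\<in>Field \<kappa>. \<exists>n. \<forall>j. n \<le> floor_log (x j) \<longrightarrow>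
      \<not> (\<forall>i<n. bit (x j) i = c \<alpha> (floor_log (x j)) i)" by simp
  then obtain N where N: "\<forall>\<alpha>\<in>Field \<kappa>. \<forall>j. N \<alpha> \<le> floor_log (x j) \<longrightarrow>
      \<not> (\<forall>i<N \<alpha>. bit (x j) i = c \<alpha> (floor_log (x j)) i)"
    unfolding bchoice_iff by (elim exE) (rule that)
  define l where "l j = floor_log (x j)" for j
  have l: "strict_mono l" using mono by (simp add: l_def[abs_def])
  text \<open>Only the blocks at indices in the range of \<open>l\<close> are nonempty, since only there do the
    digits of all later members of the sequence agree with \<open>s\<close> up to the index.\<close>
  define K where "K n = {\<alpha> \<in> Field \<kappa>. n = l (N \<alpha>)}" for n
  have "indexed_partition K (Field \<kappa>)"
    by (auto simp: indexed_partition_def K_def disjoint_family_on_def)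
  moreover have "infinite (range l)"
    using l by (simp add: finite_image_iff strict_mono_imp_inj_on)
  ultimately have "\<exists>n. \<forall>\<sigma>. \<exists>\<alpha>\<in>K n. \<exists>k\<in>range l. k > n \<and> (\<forall>i<n + 1. \<sigma> i = c \<alpha> k i)"
    using assms(1)[unfolded tortuous_def, rule_format, of "range l" K] by blast
  then obtain n where "\<exists>\<alpha>\<in>K n. \<exists>k\<in>range l. k > n \<and> (\<forall>i<n + 1. s i = c \<alpha> k i)"
    by blast
  then obtain \<alpha> j where \<alpha>: "\<alpha> \<in> K n" and j: "n < l j" "\<forall>i<n + 1. s i = c \<alpha> (l j) i"
    by blast
  have n: "n = l (N \<alpha>)" and "\<alpha> \<in> Field \<kappa>" using \<alpha> by (auto simp: K_def)
  \<comment> \<open>From \<open>l (N \<alpha>) = n < l j\<close> it follows that \<open>x j\<close>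
    agrees with \<open>s\<close> up to index \<open>n\<close>, as does
    \<open>c \<alpha> (l j)\<close>. Since \<open>N \<alpha> \<le> n\<close>, this is agreement of
    the length that \<open>N \<alpha>\<close> excludes.\<close>
  have "N \<alpha> < j" using j(1) strict_mono_less[OF l] by (simp add: n)
  have le: "N \<alpha> \<le> n" unfolding n using strict_mono_imp_increasing[OF l] .
  have "bit (x j) i = c \<alpha> (l j) i" if "i < N \<alpha>" for i
    using lim[rule_format, OF \<open>N \<alpha> < j\<close>, of i] j(2) that le n by (simp add: l_def)
  moreover have "N \<alpha> \<le> l j" using le j(1) by simp
  ultimately show False using N \<open>\<alpha> \<in> Field \<kappa>\<close> by (auto simp: l_def)
qed

lemma tortuous_agreement_sets_cover:
  assumes "tortuous \<kappa> c"
    and B: "\<not> (\<exists>g. \<forall>f\<in>B. \<forall>\<^sub>F n in sequentially. f n \<le> g n)"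
    and "infinite a"
  shows "\<exists>\<alpha>\<in>Field \<kappa>. \<exists>f\<in>B. infinite (a \<inter> agreement_set (c \<alpha>) f)"
proof -
  obtain x :: "nat \<Rightarrow> nat" and s where xa: "range x \<subseteq> a" and mono: "strict_mono (\<lambda>j. floor_log (x j))"
    and lim: "\<forall>j. \<forall>i<j. \<forall>m \<le> floor_log (x i). bit (x j) m = s m"
    using rapidly_converging_sequence[OF assms(3)] by blast
  obtain \<alpha> where \<alpha>: "\<alpha> \<in> Field \<kappa>"
    and "\<forall>n. \<exists>j. n \<le> floor_log (x j) \<and> (\<forall>i<n. bit (x j) i = c \<alpha> (floor_log (x j)) i)"
    using tortuous_long_agreement[OF assms(1) mono lim] by blast
  then obtain h where h: "\<forall>n. n \<le> floor_log (x (h n)) \<and>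
      (\<forall>i<n. bit (x (h n)) i = c \<alpha> (floor_log (x (h n))) i)"
    unfolding choice_iff by (elim exE) (rule that)
  \<comment> \<open>This candidate bound is exceeded infinitely often by some \<open>f\<close> in
    \<open>B\<close>. Each such \<open>n\<close> puts \<open>x (h n)\<close> into the agreement set,
    and \<open>n \<le> floor_log (x (h n))\<close> makes these members unbounded.\<close>
  have "\<not> (\<forall>f\<in>B. \<forall>\<^sub>F n in sequentially. f n \<le> floor_log (x (h n)))"
    using B unfolding not_ex by (rule spec)
  then obtain f where f: "f \<in> B" "\<not> (\<forall>\<^sub>F n in sequentially. f n \<le> floor_log (x (h n)))"
    by blast
  have "infinite (a \<inter> agreement_set (c \<alpha>) f)"
  proof
    assume "finite (a \<inter> agreement_set (c \<alpha>) f)"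
    then have "finite (floor_log ` (a \<inter> agreement_set (c \<alpha>) f))" by simp
    then obtain b where b: "\<And>y. y \<in> a \<inter> agreement_set (c \<alpha>) f \<Longrightarrow> floor_log y \<le> b"
      unfolding finite_nat_set_iff_bounded_le by blast
    have "\<not> (\<forall>n\<ge>Suc b. f n \<le> floor_log (x (h n)))"
      using f(2) unfolding eventually_sequentially not_ex by (rule spec)
    then obtain n where n: "Suc b \<le> n" "floor_log (x (h n)) < f n" by (auto simp: not_le)
    have "floor_log (x (h n)) \<le> f n \<and> (\<forall>i<n. bit (x (h n)) i = c \<alpha> (floor_log (x (h n))) i)"
      using h n(2) by simp
    then have "x (h n) \<in> a \<inter> agreement_set (c \<alpha>) f"
      unfolding agreement_set_def using xa by blast
    then have "floor_log (x (h n)) \<le> b" by (rule b)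
    moreover have "n \<le> floor_log (x (h n))" using h by blast
    ultimately show False using n(1) by simp
  qed
  then show ?thesis using \<alpha> f(1) by blast
qed

section \<open>Cardinal arithmetic and conclusion\<close>

text \<open>The pointwise sum bounds a finite family. Infinitude of \<open>B\<close> is what lets
  the product of cardinals collapse to a maximum.\<close>

lemma infinite_unbounded_family:
  assumes "\<not> (\<exists>g. \<forall>f\<in>B. \<forall>\<^sub>F n in sequentially. f n \<le> (g n :: nat))"
  shows "infinite B"
proof
  assume "finite B"
  then have "f n \<le> (\<Sum>f\<in>B. f n)" if "f \<in> B" for f n using that by (intro member_le_sum) auto
  then have "\<forall>f\<in>B. \<forall>\<^sub>F n in sequentially. f n \<le> (\<Sum>f\<in>B. f n)" by simp
  then show False using assms by meson
qed

text \<open>The successor of \<open>g\<close> escapes \<open>g\<close>. This provides the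
  nonemptiness that \<open>least_size_attained\<close> asks for.\<close>

lemma unbounded_family_exists:
  "\<not> (\<exists>g. \<forall>f\<in>UNIV. \<forall>\<^sub>F n in sequentially. f n \<le> (g n :: nat))"
proof clarify
  fix g :: "nat \<Rightarrow> nat"
  assume "\<forall>f\<in>UNIV. \<forall>\<^sub>F n in sequentially. f n \<le> g n"
  then have "\<forall>\<^sub>F n in sequentially. Suc (g n) \<le> g n" by (rule bspec) simp
  then show False by simp
qed

lemma card_of_image_ordIso: "inj_on f A \<Longrightarrow> |A| =o |f ` A|"
  by (rule card_of_ordIsoI) (rule inj_on_imp_bij_betw)

lemma card_of_Times_le_card_max:
  assumes "Card_order r" and "infinite B"
  shows "|Field r \<times> B| \<le>o card_max r |B|"
proof (cases "r \<le>o |B|")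
  case True
  have "|Field r| \<le>o |B|"
    using card_of_Field_ordIso[OF assms(1)] True by (rule ordIso_ordLeq_trans)
  then have "|Field r \<times> B| \<le>o |B|" using assms(2)
    by (intro card_of_Times_ordLeq_infinite_Field)
      (simp_all add: Field_card_of card_of_card_order_on card_of_mono1)
  then have "|Field r \<times> B| \<le>o |Inr ` B|"
    by (rule ordLeq_ordIso_trans) (rule card_of_image_ordIso, rule inj_Inr)
  then show ?thesis using True by (simp add: card_max_def Field_card_of)
next
  case False
  then have "|B| \<le>o r"
    using ordLeq_total[OF card_order_on_well_order_on[OF assms(1)] card_of_Well_order] by blast
  then have le: "|B| \<le>o |Field r|"
    by (rule ordLeq_ordIso_trans) (rule ordIso_symmetric[OF card_of_Field_ordIso[OF assms(1)]])
  \<comment> \<open>In this case \<open>r\<close> inherits infinitude from the smaller factor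
    \<open>B\<close>.\<close>
  then have "infinite (Field r)" using assms(2) by (rule card_of_ordLeq_infinite)
  then have "|Field r \<times> B| \<le>o |Field r|" using le
    by (intro card_of_Times_ordLeq_infinite_Field)
      (simp_all add: Field_card_of card_of_card_order_on card_of_mono1)
  then have "|Field r \<times> B| \<le>o |Inl ` Field r|"
    by (rule ordLeq_ordIso_trans) (rule card_of_image_ordIso, rule inj_Inl)
  then show ?thesis using False by (simp add: card_max_def)
qed

theorem theorem3p9:
  fixes \<kappa> :: "'a rel"
  assumes "Card_order \<kappa>"
    and "\<exists>c. tortuous \<kappa> c"
  shows "cov_star_Z0 \<le>o card_max \<kappa> bounding_number"
proof -
  obtain c where c: "tortuous \<kappa> c" using assms(2) by blast
  have "{F. \<not> (\<exists>g. \<forall>f\<in>F. \<forall>\<^sub>F n in sequentially. f n \<le> (g n :: nat))} \<noteq> {}"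
    using unbounded_family_exists by blast
  then obtain B where B: "\<not> (\<exists>g. \<forall>f\<in>B. \<forall>\<^sub>F n in sequentially. f n \<le> g n)"
    and bB: "bounding_number = |B|"
    unfolding bounding_number_def by (rule least_size_attained) blast
  define G where "G = (\<lambda>(\<alpha>, f). agreement_set (c \<alpha>) f) ` (Field \<kappa> \<times> B)"
  have G: "G \<in> {F. F \<subseteq> Z0 \<and> (\<forall>a. infinite a \<longrightarrow> (\<exists>b\<in>F. infinite (a \<inter> b)))}"
    using tortuous_agreement_sets_cover[OF c B] by (fastforce simp: G_def agreement_set_in_Z0)
  \<comment> \<open>\<open>G\<close> competes in the minimum that defines
    \<open>cov_star_Z0\<close>.\<close>
  then have "cov_star_Z0 \<le>o |G|"
    unfolding cov_star_Z0_def by (metis (no_types, lifting) empty_iff least_size_attained)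
  also have "|G| \<le>o |Field \<kappa> \<times> B|" unfolding G_def by (rule card_of_image)
  also have "|Field \<kappa> \<times> B| \<le>o card_max \<kappa> |B|"
    using assms(1) infinite_unbounded_family[OF B] by (rule card_of_Times_le_card_max)
  finally show ?thesis by (simp add: bB)
qed

end
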